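(* Let $(\mathfrak g,[\cdot,\cdot],\alpha)$ be a Hom-Lie algebra over $\mathbb K$, let $\mathrm{ad}(x)(y)=[x,y]$, and define $\widetilde{\mathrm{ad}}:\mathfrak g\to\mathrm{End}(\mathfrak g^* )$ by $\widetilde{\mathrm{ad}}(x)(f)=-f\circ\mathrm{ad}(x)$ and $\widetilde\alpha\in\mathrm{End}(\mathfrak g^* )$ by $\widetilde\alpha(f)=f\circ\alpha$. Then $(\mathfrak g^*,\widetilde{\mathrm{ad}},\widetilde\alpha)$ is a representation of $\mathfrak g$ if and only if $$\alpha([[x,y],z])=[x,[\alpha(y),z]]-[y,[\alpha(x),z]]\qquad\text{for all }x,y,z\in\mathfrak g.$$
   Context: $\mathbb K$ is an algebraically closed field of characteristic $0$. A Hom-Lie algebra is a triple $(\mathfrak g,[\cdot,\cdot],\alpha)$ with $[\cdot,\cdot]$ a skew-symmetric bilinear bracket and $\alpha$ a linear map such that $[\alpha(x),[y,z]]+[\alpha(y),[z,x]]+[\alpha(z),[x,y]]=0$ for all $x,y,z$. A representation of it is a triple $(V,\rho,\beta)$ with $V$ a $\mathbb K$-vector space, $\beta\in\mathrm{End}(V)$ and $\rho:\mathfrak g\to\mathrm{End}(V)$ linear with $\rho([x,y])\circ\beta=\rho(\alpha(x))\circ\rho(y)-\rho(\alpha(y))\circ\rho(x)$ for all $x,y\in\mathfrak g$. *)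

theory Defs
  imports "HOL-Computational_Algebra.Polynomial" "HOL-Library.Function_Algebras"
begin

text \<open>A Hom-Lie algebra is a vector space carried by a whole type, of arbitrary (possibly
  infinite) dimension. The map \<^term>\<open>alpha\<close> is only required to be linear; it is not
  required to be multiplicative.\<close>

locale hom_lie_algebra = vector_space scale
  for scale :: "'k::{alg_closed_field, field_char_0} \<Rightarrow> 'g::ab_group_add \<Rightarrow> 'g" +
  fixes bracket :: "'g \<Rightarrow> 'g \<Rightarrow> 'g"
    and alpha :: "'g \<Rightarrow> 'g"
  assumes bracket_linear_left: "Vector_Spaces.linear scale scale (\<lambda>x. bracket x y)"
    and bracket_linear_right: "Vector_Spaces.linear scale scale (\<lambda>y. bracket x y)"
    and bracket_skew: "bracket x y = - bracket y x"
    and alpha_linear: "Vector_Spaces.linear scale scale alpha"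
    and hom_jacobi:
      "bracket (alpha x) (bracket y z) + bracket (alpha y) (bracket z x)
        + bracket (alpha z) (bracket x y) = 0"

text \<open>The dual of a vector space with a variable scalar multiplication is not a type, only a
  subspace of a function type. The space underlying a representation is therefore a subspace
  \<^term>\<open>V\<close> of a vector space, and maps on it are total functions of which only
  the values on \<^term>\<open>V\<close> matter.\<close>

definition endo_on :: "('k::field \<Rightarrow> 'v::ab_group_add \<Rightarrow> 'v) \<Rightarrow> 'v set \<Rightarrow> ('v \<Rightarrow> 'v) set"
  where "endo_on s V =
    {T. (\<forall>v\<in>V. T v \<in> V) \<and> (\<forall>u\<in>V. \<forall>v\<in>V. T (u + v) = T u + T v) \<and>
        (\<forall>c. \<forall>v\<in>V. T (s c v) = s c (T v))}"

locale hom_lie_representation =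
  hom_lie_algebra scale bracket alpha + V: vector_space scaleV
  for scale :: "'k::{alg_closed_field, field_char_0} \<Rightarrow> 'g::ab_group_add \<Rightarrow> 'g"
    and bracket :: "'g \<Rightarrow> 'g \<Rightarrow> 'g"
    and alpha :: "'g \<Rightarrow> 'g"
    and scaleV :: "'k \<Rightarrow> 'v::ab_group_add \<Rightarrow> 'v" +
  fixes V :: "'v set"
    and rho :: "'g \<Rightarrow> 'v \<Rightarrow> 'v"
    and beta :: "'v \<Rightarrow> 'v"
  assumes subspace_V: "V.subspace V"
    and beta_endo: "beta \<in> endo_on scaleV V"
    and rho_endo: "rho x \<in> endo_on scaleV V"
    and rho_add: "v \<in> V \<Longrightarrow> rho (x + y) v = rho x v + rho y v"
    and rho_scale: "v \<in> V \<Longrightarrow> rho (scale c x) v = scaleV c (rho x v)"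
    and rho_bracket:
      "v \<in> V \<Longrightarrow>
        (rho (bracket x y) \<circ> beta) v
          = (rho (alpha x) \<circ> rho y) v - (rho (alpha y) \<circ> rho x) v"

text \<open>The full algebraic dual, inside all functions to the field with pointwise operations.\<close>

definition dual_space :: "('k::field \<Rightarrow> 'g::ab_group_add \<Rightarrow> 'g) \<Rightarrow> ('g \<Rightarrow> 'k) set"
  where "dual_space scale = {f. Vector_Spaces.linear scale (*) f}"

definition fun_scale :: "'k::field \<Rightarrow> ('g \<Rightarrow> 'k) \<Rightarrow> 'g \<Rightarrow> 'k"
  where "fun_scale c f = (\<lambda>x. c * f x)"

definition ad :: "('g \<Rightarrow> 'g \<Rightarrow> 'g) \<Rightarrow> 'g \<Rightarrow> 'g \<Rightarrow> 'g"
  where "ad bracket x = (\<lambda>y. bracket x y)"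

definition ad_tilde :: "('g \<Rightarrow> 'g \<Rightarrow> 'g) \<Rightarrow> 'g \<Rightarrow> ('g \<Rightarrow> 'k::field) \<Rightarrow> 'g \<Rightarrow> 'k"
  where "ad_tilde bracket x f = - (f \<circ> ad bracket x)"

definition alpha_tilde :: "('g \<Rightarrow> 'g) \<Rightarrow> ('g \<Rightarrow> 'k::field) \<Rightarrow> 'g \<Rightarrow> 'k"
  where "alpha_tilde alpha f = f \<circ> alpha"

lemma vector_space_fun_scale: "vector_space (fun_scale :: 'k::field \<Rightarrow> ('g \<Rightarrow> 'k) \<Rightarrow> 'g \<Rightarrow> 'k)"
  by unfold_locales (auto simp: fun_scale_def fun_eq_iff algebra_simps)

end

theory Submission
  imports Defs
begin

text \<open>Evaluated at a functional \<open>f\<close> and a vector \<open>z\<close>, the representation identity says that \<open>f\<close>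
  takes the same value on both sides of the identity in \<open>\<gg>\<close>. Since the full dual
  separates points, this holds for all \<open>f\<close> exactly if the two sides agree. All other
  requirements on a representation hold by linearity.\<close>

text \<open>A nonzero \<open>u - v\<close> extends to a basis, so some functional sends it to 1. The
  basis may be infinite, so this covers every dimension.\<close>

lemma (in vector_space) linear_functional_separates:
  assumes "\<And>f. Vector_Spaces.linear scale (*) f \<Longrightarrow> f u = f v"
  shows "u = v"
proof (rule ccontr)
  assume "u \<noteq> v"
  interpret field: vector_space "(*) :: 'a \<Rightarrow> 'a \<Rightarrow> 'a"
    by unfold_locales (simp_all add: algebra_simps)
  interpret pair: vector_space_pair scale "(*) :: 'a \<Rightarrow> 'a \<Rightarrow> 'a" ..
  have "independent {u - v}"
    using \<open>u \<noteq> v\<close> by simp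
  then obtain f where f: "Vector_Spaces.linear scale (*) f" and "f (u - v) = 1"
    using pair.linear_independent_extend[of "{u - v}" "\<lambda>_. 1"] by auto
  then have "f u - f v = 1"
    using pair.linear_diff by metis
  with assms[OF f] show False
    by simp
qed

context hom_lie_algebra
begin

text \<open>\<open>Vector_Spaces.linear\<close> also contains the vector space axioms of both sides;
  these hold here, which leaves two equations usable for rewriting.\<close>

lemma dual_iff:
  "f \<in> dual_space scale \<longleftrightarrow>
    (\<forall>u v. f (u + v) = f u + f v) \<and> (\<forall>c u. f (scale c u) = c * f u)"
proof -
  have "vector_space ((*) :: 'k \<Rightarrow> 'k \<Rightarrow> 'k)"
    by unfold_locales (simp_all add: algebra_simps)
  then show ?thesis
    using vector_space_axioms
    by (auto simp: dual_space_def Vector_Spaces.linear_iff)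
qed

lemma representation_dual_iff:
  "hom_lie_representation scale bracket alpha
      fun_scale (dual_space scale) (ad_tilde bracket) (alpha_tilde alpha)
    \<longleftrightarrow> (\<forall>x y z. alpha (bracket (bracket x y) z)
          = bracket x (bracket (alpha y) z) - bracket y (bracket (alpha x) z))"
    (is "?rep \<longleftrightarrow> ?identity")
proof -
  interpret dual: vector_space "fun_scale :: 'k \<Rightarrow> ('g \<Rightarrow> 'k) \<Rightarrow> 'g \<Rightarrow> 'k"
    by (rule vector_space_fun_scale)
  note lin_simps = bracket_linear_left[unfolded Vector_Spaces.linear_iff]
    bracket_linear_right[unfolded Vector_Spaces.linear_iff] alpha_linear[unfolded Vector_Spaces.linear_iff]
  note tilde = ad_tilde_def alpha_tilde_def ad_def fun_scale_def fun_eq_iff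
  \<comment> \<open>Additivity applied to \<open>(u - v) + v\<close>.\<close>
  have diff: "f (u - v) = f u - f v" if "f \<in> dual_space scale" for f u v
    using that dual_iff by (metis add_diff_cancel diff_add_cancel)
  have "dual.subspace (dual_space scale)"
    by (auto simp: dual.subspace_def dual_iff fun_scale_def algebra_simps)
  moreover have "alpha_tilde alpha \<in> endo_on fun_scale (dual_space scale)"
    by (auto simp: endo_on_def dual_iff tilde lin_simps)
  moreover have "ad_tilde bracket x \<in> endo_on fun_scale (dual_space scale)" for x
    by (auto simp: endo_on_def dual_iff tilde lin_simps)
  moreover have "ad_tilde bracket (x + y) f = ad_tilde bracket x f + ad_tilde bracket y f"
    if "f \<in> dual_space scale" for x y f
    using that by (auto simp: dual_iff tilde lin_simps)
  moreover have "ad_tilde bracket (scale c x) f = fun_scale c (ad_tilde bracket x f)"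
    if "f \<in> dual_space scale" for c x f
    using that by (auto simp: dual_iff tilde lin_simps)
  \<comment> \<open>The facts collected above discharge every representation axiom except
    \<open>rho_bracket\<close>, which stays on the right.\<close>
  ultimately have "?rep \<longleftrightarrow> (\<forall>f\<in>dual_space scale. \<forall>x y.
      (ad_tilde bracket (bracket x y) \<circ> alpha_tilde alpha) f
        = (ad_tilde bracket (alpha x) \<circ> ad_tilde bracket y) f
          - (ad_tilde bracket (alpha y) \<circ> ad_tilde bracket x) f)"
    using hom_lie_algebra_axioms dual.vector_space_axioms
    by (auto simp: hom_lie_representation_def hom_lie_representation_axioms_def)
  \<comment> \<open>At \<open>z\<close>, the two signs in a composite of \<open>ad_tilde\<close>
    cancel and the order of the brackets reverses: the outer bracket is with \<open>y\<close> in the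
    first term, with \<open>x\<close> in the second. The left side keeps one sign; negating the
    equation swaps the two terms.\<close>
  also have "\<dots> \<longleftrightarrow> (\<forall>f\<in>dual_space scale. \<forall>x y z. f (alpha (bracket (bracket x y) z))
      = f (bracket x (bracket (alpha y) z) - bracket y (bracket (alpha x) z)))"
    by (simp add: diff tilde) (metis minus_diff_eq minus_equation_iff)
  \<comment> \<open>For fixed \<open>x\<close>, \<open>y\<close>, \<open>z\<close> all functionals
    agree on the two vectors, so separation of points makes them equal; the converse is
    substitution.\<close>
  also have "\<dots> \<longleftrightarrow> ?identity"
    using linear_functional_separates by (fastforce simp: dual_space_def)
  finally show ?thesis .
qed

end

theorem corollary2p6:
  fixes scale :: "'k::{alg_closed_field, field_char_0} \<Rightarrow> 'g::ab_group_add \<Rightarrow> 'g"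
    and bracket :: "'g \<Rightarrow> 'g \<Rightarrow> 'g"
    and alpha :: "'g \<Rightarrow> 'g"
  assumes "hom_lie_algebra scale bracket alpha"
  shows "hom_lie_representation scale bracket alpha
           fun_scale (dual_space scale) (ad_tilde bracket) (alpha_tilde alpha)
         \<longleftrightarrow> (\<forall>x y z. alpha (bracket (bracket x y) z)
               = bracket x (bracket (alpha y) z) - bracket y (bracket (alpha x) z))"
  using assms by (rule hom_lie_algebra.representation_dual_iff)

end
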